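(* Let $G$ be a graph without isolated vertices and let $B\subseteq A\subseteq V(G)$. Then (i) $\gamma_{Zg}(G|A)\le \gamma_{Zg}(G|B)$ and $\gamma_{Zg}'(G|A)\le \gamma_{Zg}'(G|B)$; (ii) $\gamma_{LLg}(G|A)\le \gamma_{LLg}(G|B)$ and $\gamma_{LLg}'(G|A)\le \gamma_{LLg}'(G|B)$; and (iii) $\gamma_{Lg}(G|A)\le \gamma_{Lg}(G|B)$ and $\gamma_{Lg}'(G|A)\le \gamma_{Lg}'(G|B)$.
   Context: All graphs are finite and simple. For a vertex $v$ of a graph $G$, $N(v)$ is its open neighborhood and $N[v]=N(v)\cup\{v\}$ its closed neighborhood. Two players, Dominator and Staller, alternately select a vertex of $G$. For $A\subseteq V(G)$, $G|A$ denotes the graph $G$ in which the vertices of $A$ are regarded as pre-dominated: they need not be dominated, but they may be played if the move is legal. In the $i$-th move of a game on $G|A$, after the moves $v_1,\dots,v_{i-1}$, the choice of a vertex $v_i\in V(G)$ is legal if - in the Z-domination game: $N(v_i)\setminus\bigl(A\cup\bigcup_{j=1}^{i-1}N[v_j]\bigr)\neq\emptyset$; - in the LL-domination game: $N[v_i]\setminus\bigl(A\cup\bigcup_{j=1}^{i-1}N(v_j)\bigr)\neq\emptyset$; - in the L-domination game: $N[v_i]\setminus\bigl(A\cup\bigcup_{j=1}^{i-1}N(v_j)\bigr)\neq\emptyset$ and $v_i\neq v_j$ for all $j<i$. The game ends when no legal move is available; its length is the total number of moves played (an unending play, possible in the LL-game since vertices may be repeated there, has infinite length). Dominator wants to minimize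 the length, Staller wants to maximize it. In a D-game Dominator moves first; in an S-game Staller moves first. The numbers $\gamma_{Zg}(G|A)$, $\gamma_{Lg}(G|A)$, $\gamma_{LLg}(G|A)$ are the lengths, under optimal play by both players, of the D-game on $G|A$ for the Z-, L-, and LL-domination game, respectively; $\gamma_{Zg}'(G|A)$, $\gamma_{Lg}'(G|A)$, $\gamma_{LLg}'(G|A)$ are the analogous numbers for the S-game. *)

theory Defs
  imports "Graph_Theory.Digraph" "HOL-Library.Extended_Nat"
begin

section \<open>Neighborhoods\<close>

text \<open>
  A finite simple graph is a \<open>graph\<close> in the sense of the entry Graph_Theory, that is, a finite
  symmetric digraph without loops and without parallel arcs.
\<close>

definition nbhd :: "('a, 'b) pre_digraph \<Rightarrow> 'a \<Rightarrow> 'a set" where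
  "nbhd G v = {u \<in> verts G. v \<rightarrow>\<^bsub>G\<^esub> u}"

definition closed_nbhd :: "('a, 'b) pre_digraph \<Rightarrow> 'a \<Rightarrow> 'a set" where
  "closed_nbhd G v = insert v (nbhd G v)"

definition no_isolated_vertices :: "('a, 'b) pre_digraph \<Rightarrow> bool" where
  "no_isolated_vertices G \<longleftrightarrow> (\<forall>v\<in>verts G. nbhd G v \<noteq> {})"


section \<open>Legal moves\<close>

text \<open>
  A history is the list of all earlier moves, oldest first. In the predicates below \<open>A\<close> is the
  set of pre-dominated vertices, \<open>h\<close> is the history, and \<open>v\<close> is the move to be made.
\<close>

definition legal_Z :: "('a, 'b) pre_digraph \<Rightarrow> 'a set \<Rightarrow> 'a list \<Rightarrow> 'a \<Rightarrow> bool" where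
  "legal_Z G A h v \<longleftrightarrow>
     v \<in> verts G \<and> nbhd G v - (A \<union> (\<Union>w\<in>set h. closed_nbhd G w)) \<noteq> {}"

definition legal_LL :: "('a, 'b) pre_digraph \<Rightarrow> 'a set \<Rightarrow> 'a list \<Rightarrow> 'a \<Rightarrow> bool" where
  "legal_LL G A h v \<longleftrightarrow>
     v \<in> verts G \<and> closed_nbhd G v - (A \<union> (\<Union>w\<in>set h. nbhd G w)) \<noteq> {}"

definition legal_L :: "('a, 'b) pre_digraph \<Rightarrow> 'a set \<Rightarrow> 'a list \<Rightarrow> 'a \<Rightarrow> bool" where
  "legal_L G A h v \<longleftrightarrow>
     v \<in> verts G \<and> closed_nbhd G v - (A \<union> (\<Union>w\<in>set h. nbhd G w)) \<noteq> {} \<and> v \<notin> set h"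


section \<open>Game lengths under optimal play\<close>

datatype player = Dominator | Staller

text \<open>\<open>turn p n\<close> is the player to move after \<open>n\<close> moves when \<open>p\<close> makes the first move.\<close>

definition turn :: "player \<Rightarrow> nat \<Rightarrow> player" where
  "turn p n = (if even n then p else (case p of Dominator \<Rightarrow> Staller | Staller \<Rightarrow> Dominator))"

text \<open>
  A strategy answers every history at which some move is legal with a legal move; its value at
  the other histories is never used.
\<close>

definition strategies :: "('a list \<Rightarrow> 'a \<Rightarrow> bool) \<Rightarrow> ('a list \<Rightarrow> 'a) set" where
  "strategies legal = {\<sigma>. \<forall>h. (\<exists>v. legal h v) \<longrightarrow> legal h (\<sigma> h)}"

text \<open>
  \<open>play legal p \<sigma> \<tau> n\<close> is the history after \<open>n\<close> rounds, with Dominator following \<open>\<sigma>\<close> and Staller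
  following \<open>\<tau>\<close>; it stays constant once no legal move is left.
\<close>

primrec play :: "('a list \<Rightarrow> 'a \<Rightarrow> bool) \<Rightarrow> player \<Rightarrow> ('a list \<Rightarrow> 'a) \<Rightarrow> ('a list \<Rightarrow> 'a) \<Rightarrow> nat \<Rightarrow> 'a list"
  where
    "play legal p \<sigma> \<tau> 0 = []"
  | "play legal p \<sigma> \<tau> (Suc n) =
      (let h = play legal p \<sigma> \<tau> n in
       if \<exists>v. legal h v
       then h @ [case turn p (length h) of Dominator \<Rightarrow> \<sigma> h | Staller \<Rightarrow> \<tau> h]
       else h)"

text \<open>The length of an unending play is \<open>\<infinity>\<close>.\<close>

definition play_length ::
  "('a list \<Rightarrow> 'a \<Rightarrow> bool) \<Rightarrow> player \<Rightarrow> ('a list \<Rightarrow> 'a) \<Rightarrow> ('a list \<Rightarrow> 'a) \<Rightarrow> enat" where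
  "play_length legal p \<sigma> \<tau> = (SUP n. enat (length (play legal p \<sigma> \<tau> n)))"

text \<open>
  Dominator, whose strategy is \<open>\<sigma>\<close>, minimizes, and Staller, whose strategy is \<open>\<tau>\<close>, maximizes.
  By \<open>game_length_determined\<close> below, the infimum and the supremum may be interchanged.
\<close>

definition game_length :: "('a list \<Rightarrow> 'a \<Rightarrow> bool) \<Rightarrow> player \<Rightarrow> enat" where
  "game_length legal p =
     (INF \<sigma>\<in>strategies legal. SUP \<tau>\<in>strategies legal. play_length legal p \<sigma> \<tau>)"

definition gamma_Zg :: "('a, 'b) pre_digraph \<Rightarrow> 'a set \<Rightarrow> enat" where
  "gamma_Zg G A = game_length (legal_Z G A) Dominator"

definition gamma_Zg' :: "('a, 'b) pre_digraph \<Rightarrow> 'a set \<Rightarrow> enat" where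
  "gamma_Zg' G A = game_length (legal_Z G A) Staller"

definition gamma_Lg :: "('a, 'b) pre_digraph \<Rightarrow> 'a set \<Rightarrow> enat" where
  "gamma_Lg G A = game_length (legal_L G A) Dominator"

definition gamma_Lg' :: "('a, 'b) pre_digraph \<Rightarrow> 'a set \<Rightarrow> enat" where
  "gamma_Lg' G A = game_length (legal_L G A) Staller"

definition gamma_LLg :: "('a, 'b) pre_digraph \<Rightarrow> 'a set \<Rightarrow> enat" where
  "gamma_LLg G A = game_length (legal_LL G A) Dominator"

definition gamma_LLg' :: "('a, 'b) pre_digraph \<Rightarrow> 'a set \<Rightarrow> enat" where
  "gamma_LLg' G A = game_length (legal_LL G A) Staller"


section \<open>Determinacy\<close>

text \<open>\<open>forces legal p k h\<close>: from \<open>h\<close>, Dominator can end the game within \<open>k\<close> further moves.\<close>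

primrec forces :: "('a list \<Rightarrow> 'a \<Rightarrow> bool) \<Rightarrow> player \<Rightarrow> nat \<Rightarrow> 'a list \<Rightarrow> bool" where
  "forces legal p 0 h \<longleftrightarrow> (\<forall>v. \<not> legal h v)"
| "forces legal p (Suc k) h \<longleftrightarrow>
     (\<forall>v. \<not> legal h v) \<or>
     (case turn p (length h) of
        Dominator \<Rightarrow> \<exists>v. legal h v \<and> forces legal p k (h @ [v])
      | Staller \<Rightarrow> \<forall>v. legal h v \<longrightarrow> forces legal p k (h @ [v]))"

lemma length_play_le: "length (play legal p \<sigma> \<tau> n) \<le> n"
  by (induction n) (auto simp: Let_def)

lemma forces_imp_strategy:
  assumes "forces legal p k []"
  shows "\<exists>\<sigma>\<in>strategies legal. \<forall>\<tau>\<in>strategies legal. play_length legal p \<sigma> \<tau> \<le> enat k"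
proof -
  define good where "good = (\<lambda>h v. legal h v \<and>
    (forces legal p (k - Suc (length h)) (h @ [v]) \<or>
     (\<forall>w. legal h w \<longrightarrow> \<not> forces legal p (k - Suc (length h)) (h @ [w]))))"
  define \<sigma> where "\<sigma> = (\<lambda>h. SOME v. good h v)"
  have good: "good h (\<sigma> h)" if "\<exists>v. legal h v" for h
    unfolding \<sigma>_def by (rule someI_ex) (use that in \<open>auto simp: good_def\<close>)
  have \<sigma>: "\<sigma> \<in> strategies legal"
    using good by (auto simp: strategies_def good_def)
  have "play_length legal p \<sigma> \<tau> \<le> enat k" if \<tau>: "\<tau> \<in> strategies legal" for \<tau>
  proof -
    have "length (play legal p \<sigma> \<tau> n) \<le> k \<and>
      forces legal p (k - length (play legal p \<sigma> \<tau> n)) (play legal p \<sigma> \<tau> n)" for n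
    proof (induction n)
      case 0
      show ?case using assms by simp
    next
      case (Suc n)
      define h where "h = play legal p \<sigma> \<tau> n"
      have h: "length h \<le> k" "forces legal p (k - length h) h"
        using Suc by (auto simp: h_def)
      show ?case
      proof (cases "\<exists>v. legal h v")
        case False
        then show ?thesis using h by (auto simp: h_def[symmetric] Let_def)
      next
        case True
        with h(2) have "k - length h \<noteq> 0" by (cases "k - length h") auto
        then have k: "k - length h = Suc (k - Suc (length h))" "Suc (length h) \<le> k" by auto
        have \<tau>h: "legal h (\<tau> h)" using \<tau> True by (auto simp: strategies_def)
        show ?thesis
        proof (cases "turn p (length h)")
          case Dominator
          with h(2) k True have "\<exists>v. legal h v \<and> forces legal p (k - Suc (length h)) (h @ [v])"
            by auto
          with good[OF True] have "forces legal p (k - Suc (length h)) (h @ [\<sigma> h])"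
            by (auto simp: good_def)
          then show ?thesis using True Dominator k by (auto simp: h_def[symmetric] Let_def)
        next
          case Staller
          with h(2) k True \<tau>h have "forces legal p (k - Suc (length h)) (h @ [\<tau> h])"
            by auto
          then show ?thesis using True Staller k by (auto simp: h_def[symmetric] Let_def)
        qed
      qed
    qed
    then show ?thesis by (auto simp: play_length_def intro!: SUP_least)
  qed
  with \<sigma> show ?thesis by blast
qed

lemma not_forces_imp_strategy:
  assumes "\<not> forces legal p k []"
  shows "\<exists>\<tau>\<in>strategies legal. \<forall>\<sigma>\<in>strategies legal. enat (Suc k) \<le> play_length legal p \<sigma> \<tau>"
proof -
  define good where "good = (\<lambda>h v. legal h v \<and>
    (\<not> forces legal p (k - Suc (length h)) (h @ [v]) \<or>
     (\<forall>w. legal h w \<longrightarrow> forces legal p (k - Suc (length h)) (h @ [w]))))"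
  define \<tau> where "\<tau> = (\<lambda>h. SOME v. good h v)"
  have good: "good h (\<tau> h)" if "\<exists>v. legal h v" for h
    unfolding \<tau>_def by (rule someI_ex) (use that in \<open>auto simp: good_def\<close>)
  have \<tau>: "\<tau> \<in> strategies legal"
    using good by (auto simp: strategies_def good_def)
  have "enat (Suc k) \<le> play_length legal p \<sigma> \<tau>" if \<sigma>: "\<sigma> \<in> strategies legal" for \<sigma>
  proof -
    have *: "length (play legal p \<sigma> \<tau> n) = n \<and> \<not> forces legal p (k - n) (play legal p \<sigma> \<tau> n)"
      if "n \<le> k" for n
      using that
    proof (induction n)
      case 0
      show ?case using assms by simp
    next
      case (Suc n)
      define h where "h = play legal p \<sigma> \<tau> n"
      have h: "length h = n" "\<not> forces legal p (k - n) h"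
        using Suc by (auto simp: h_def)
      have k: "k - n = Suc (k - Suc n)" using Suc.prems by auto
      have True: "\<exists>v. legal h v" using h(2) k by auto
      have \<sigma>h: "legal h (\<sigma> h)" using \<sigma> True by (auto simp: strategies_def)
      show ?case
      proof (cases "turn p n")
        case Dominator
        with h k \<sigma>h have "\<not> forces legal p (k - Suc n) (h @ [\<sigma> h])" by auto
        then show ?thesis using True Dominator h by (auto simp: h_def[symmetric] Let_def)
      next
        case Staller
        with h k have "\<exists>v. legal h v \<and> \<not> forces legal p (k - Suc n) (h @ [v])" by auto
        with good[OF True] h have "\<not> forces legal p (k - Suc n) (h @ [\<tau> h])"
          by (auto simp: good_def)
        then show ?thesis using True Staller h by (auto simp: h_def[symmetric] Let_def)
      qed
    qed
    from *[of k] have "length (play legal p \<sigma> \<tau> (Suc k)) = Suc k"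
      by (auto simp: Let_def)
    then show ?thesis
      unfolding play_length_def by (metis SUP_upper UNIV_I)
  qed
  with \<tau> show ?thesis by blast
qed

lemma game_length_le_iff_forces: "game_length legal p \<le> enat k \<longleftrightarrow> forces legal p k []"
proof
  assume "forces legal p k []"
  then obtain \<sigma> where "\<sigma> \<in> strategies legal"
    "\<forall>\<tau>\<in>strategies legal. play_length legal p \<sigma> \<tau> \<le> enat k"
    using forces_imp_strategy by blast
  then show "game_length legal p \<le> enat k"
    unfolding game_length_def by (intro INF_lower2[of \<sigma>]) (auto intro: SUP_least)
next
  assume *: "game_length legal p \<le> enat k"
  show "forces legal p k []"
  proof (rule ccontr)
    assume "\<not> forces legal p k []"
    then obtain \<tau> where "\<tau> \<in> strategies legal"
      "\<forall>\<sigma>\<in>strategies legal. enat (Suc k) \<le> play_length legal p \<sigma> \<tau>"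
      using not_forces_imp_strategy by blast
    then have "enat (Suc k) \<le> game_length legal p"
      unfolding game_length_def by (intro INF_greatest SUP_upper2[of \<tau>]) auto
    with * have "enat (Suc k) \<le> enat k" by (rule order_trans[rotated])
    then show False by simp
  qed
qed

lemma game_length_determined:
  "game_length legal p =
     (SUP \<tau>\<in>strategies legal. INF \<sigma>\<in>strategies legal. play_length legal p \<sigma> \<tau>)" (is "_ = ?S")
proof (rule antisym)
  show "?S \<le> game_length legal p"
    unfolding game_length_def
    by (intro SUP_least INF_greatest) (blast intro: INF_lower SUP_upper order_trans)
  show "game_length legal p \<le> ?S"
  proof (rule ccontr)
    assume less: "\<not> game_length legal p \<le> ?S"
    then obtain k where k: "?S = enat k"
      by (cases ?S) auto
    with less have "\<not> forces legal p k []"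
      by (simp add: game_length_le_iff_forces)
    then obtain \<tau> where "\<tau> \<in> strategies legal"
      "\<forall>\<sigma>\<in>strategies legal. enat (Suc k) \<le> play_length legal p \<sigma> \<tau>"
      using not_forces_imp_strategy by blast
    then have "enat (Suc k) \<le> ?S"
      by (intro SUP_upper2[of \<tau>] INF_greatest) auto
    with k show False by simp
  qed
qed

end

(*
  Imagination strategy: while playing on G|A, Dominator imagines a game on G|B in which he plays
  optimally, and keeps every vertex that is dominated in the imagined game dominated in the real
  one. Staller's real moves are then legal in the imagined game and are copied there. If
  Dominator's imagined move v is not legal in the real game, he makes another move instead. In the
  LL- and L-game the vertices that v dominates are already dominated in the real game, so any
  legal move will do; in the L-game, v moreover stays illegal in the real game. In the Z-game,
  only N(v) need be dominated already; if v is not, then a neighbor of v is a legal move, and it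
  dominates v.
*)

theory Submission
  imports Defs
begin

text \<open>The imagination strategy for an arbitrary invariant \<open>R\<close> between a real
  history \<open>h\<close> and an imagined one \<open>h'\<close>. Moves are appended in pairs, so
  the lengths agree and the same player is to move in both games. \<open>replace\<close> may assume
  a legal \<open>w\<close>: without one the real game is over.\<close>

lemma forces_simulation:
  assumes legal: "\<And>h h' v. R h h' \<Longrightarrow> legal h v \<Longrightarrow> legal' h' v"
    and copy: "\<And>h h' v. R h h' \<Longrightarrow> legal h v \<Longrightarrow> R (h @ [v]) (h' @ [v])"
    and replace: "\<And>h h' v w. R h h' \<Longrightarrow> legal' h' v \<Longrightarrow> \<not> legal h v \<Longrightarrow> legal h w \<Longrightarrow>
      \<exists>u. legal h u \<and> R (h @ [u]) (h' @ [v])"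
    and "R h h'" "length h = length h'" "forces legal' p k h'"
  shows "forces legal p k h"
  using assms(4-6)
proof (induction k arbitrary: h h')
  case 0
  then show ?case using legal by auto
next
  case (Suc k)
  show ?case
  proof (cases "\<exists>w. legal h w")
    case True
    then obtain w where w: "legal h w" by blast
    then have w': "legal' h' w" using legal Suc.prems by blast
    show ?thesis
    proof (cases "turn p (length h)")
      case Dominator
      then obtain v where v: "legal' h' v" "forces legal' p k (h' @ [v])"
        using Suc.prems w' by auto
      \<comment> \<open>\<open>u\<close> is \<open>v\<close> itself if \<open>v\<close> is legal
        after \<open>h\<close>, and its replacement otherwise.\<close>
      obtain u where u: "legal h u" "R (h @ [u]) (h' @ [v])"
        using copy[OF Suc.prems(1)] replace[OF Suc.prems(1) v(1) _ w] by metis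
      have "forces legal p k (h @ [u])"
        using Suc.IH[OF u(2) _ v(2)] Suc.prems(2) by simp
      then show ?thesis using u Dominator by auto
    next
      case Staller
      have "forces legal p k (h @ [v])" if "legal h v" for v
        using Suc.IH[OF copy[OF Suc.prems(1) that]] Suc.prems(2,3) Staller w'
          legal[OF Suc.prems(1) that] by auto
      then show ?thesis using Staller by auto
    qed
  qed auto
qed

lemma game_length_simulation:
  assumes "R [] []"
    and "\<And>h h' v. R h h' \<Longrightarrow> legal h v \<Longrightarrow> legal' h' v"
    and "\<And>h h' v. R h h' \<Longrightarrow> legal h v \<Longrightarrow> R (h @ [v]) (h' @ [v])"
    and "\<And>h h' v w. R h h' \<Longrightarrow> legal' h' v \<Longrightarrow> \<not> legal h v \<Longrightarrow> legal h w \<Longrightarrow>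
      \<exists>u. legal h u \<and> R (h @ [u]) (h' @ [v])"
  shows "game_length legal p \<le> game_length legal' p"
proof (cases "game_length legal' p")
  case (enat k)
  then have "forces legal' p k []"
    by (simp flip: game_length_le_iff_forces)
  then have "forces legal p k []"
    using forces_simulation[of R legal legal' "[]" "[]" p k] assms by simp
  then show ?thesis
    by (simp add: enat game_length_le_iff_forces)
\<comment> \<open>In the remaining case the imagined game has value
  \<open>\<infinity>\<close>.\<close>
qed simp

lemma nbhd_sym:
  assumes "graph G" "u \<in> nbhd G v" "v \<in> verts G"
  shows "v \<in> nbhd G u"
proof -
  interpret graph G by fact
  show ?thesis using assms(2,3) arcs_ends_symmetric[OF sym_arcs] by (auto simp: nbhd_def)
qed

lemma game_length_Z_antimono:
  assumes "graph G" "no_isolated_vertices G" "B \<subseteq> A"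
  shows "game_length (legal_Z G A) p \<le> game_length (legal_Z G B) p"
proof (rule game_length_simulation[where
      R = "\<lambda>h h'. B \<union> (\<Union>w\<in>set h'. closed_nbhd G w) \<subseteq> A \<union> (\<Union>w\<in>set h. closed_nbhd G w)"])
  fix h h' v w
  let ?D = "A \<union> (\<Union>w\<in>set h. closed_nbhd G w)"
  assume R: "B \<union> (\<Union>w\<in>set h'. closed_nbhd G w) \<subseteq> ?D"
    and v: "legal_Z G B h' v" "\<not> legal_Z G A h v" and w: "legal_Z G A h w"
  then have "v \<in> verts G" and N: "nbhd G v \<subseteq> ?D"
    by (auto simp: legal_Z_def)
  show "\<exists>u. legal_Z G A h u \<and> B \<union> (\<Union>w\<in>set (h' @ [v]). closed_nbhd G w)
      \<subseteq> A \<union> (\<Union>w\<in>set (h @ [u]). closed_nbhd G w)"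
  proof (cases "v \<in> ?D")
    case True
    then show ?thesis using R N w by (intro exI[of _ w]) (auto simp: closed_nbhd_def[of G v])
  next
    case False
    \<comment> \<open>As \<open>v\<close> is not isolated, it has a neighbor \<open>u\<close>; by
      symmetry \<open>v\<close> lies in \<open>nbhd G u\<close>, so playing \<open>u\<close>
      dominates the one vertex of \<open>closed_nbhd G v\<close> still missing from
      \<open>?D\<close>.\<close>
    obtain u where "u \<in> nbhd G v"
      using assms(2) \<open>v \<in> verts G\<close> by (auto simp: no_isolated_vertices_def)
    then have u: "v \<in> nbhd G u" "u \<in> verts G"
      using nbhd_sym[OF assms(1)] \<open>v \<in> verts G\<close> by (auto simp: nbhd_def)
    then have "legal_Z G A h u" using False by (auto simp: legal_Z_def)
    moreover have "closed_nbhd G v \<subseteq> ?D \<union> closed_nbhd G u"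
      using N u by (auto simp: closed_nbhd_def)
    ultimately show ?thesis using R by (intro exI[of _ u]) auto
  qed
\<comment> \<open>For empty histories the invariant is \<open>B \<subseteq> A\<close>. A vertex
  undominated in the real game is undominated in the imagined one, so real moves can be
  copied.\<close>
qed (use assms(3) in \<open>fastforce simp: legal_Z_def\<close>)+

lemma game_length_LL_antimono:
  assumes "B \<subseteq> A"
  shows "game_length (legal_LL G A) p \<le> game_length (legal_LL G B) p"
proof (rule game_length_simulation[where
      R = "\<lambda>h h'. B \<union> (\<Union>w\<in>set h'. nbhd G w) \<subseteq> A \<union> (\<Union>w\<in>set h. nbhd G w)"])
  fix h h' v w
  assume R: "B \<union> (\<Union>w\<in>set h'. nbhd G w) \<subseteq> A \<union> (\<Union>w\<in>set h. nbhd G w)"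
    and v: "legal_LL G B h' v" "\<not> legal_LL G A h v" and w: "legal_LL G A h w"
  from v have "nbhd G v \<subseteq> A \<union> (\<Union>w\<in>set h. nbhd G w)"
    by (auto simp: legal_LL_def closed_nbhd_def)
  then show "\<exists>u. legal_LL G A h u \<and>
      B \<union> (\<Union>w\<in>set (h' @ [v]). nbhd G w) \<subseteq> A \<union> (\<Union>w\<in>set (h @ [u]). nbhd G w)"
    using R w by (intro exI[of _ w]) auto
qed (use assms in \<open>fastforce simp: legal_LL_def\<close>)+

lemma game_length_L_antimono:
  assumes "B \<subseteq> A"
  shows "game_length (legal_L G A) p \<le> game_length (legal_L G B) p"
\<comment> \<open>After replacements, \<open>h'\<close> can contain vertices outside
  \<open>h\<close>. The second conjunct ensures that a real legal move does not repeat a vertex of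
  \<open>h'\<close>.\<close>
proof (rule game_length_simulation[where
      R = "\<lambda>h h'. B \<union> (\<Union>w\<in>set h'. nbhd G w) \<subseteq> A \<union> (\<Union>w\<in>set h. nbhd G w)
        \<and> (\<forall>v\<in>set h'. \<not> legal_L G A h v)"])
  fix h h' v w
  assume R: "B \<union> (\<Union>w\<in>set h'. nbhd G w) \<subseteq> A \<union> (\<Union>w\<in>set h. nbhd G w)
      \<and> (\<forall>v\<in>set h'. \<not> legal_L G A h v)"
    and v: "legal_L G B h' v" "\<not> legal_L G A h v" and w: "legal_L G A h w"
  \<comment> \<open>If \<open>v\<close> is illegal because it occurs in \<open>h\<close>, then
    \<open>nbhd G v\<close> is itself part of the union.\<close>
  from v have "nbhd G v \<subseteq> A \<union> (\<Union>w\<in>set h. nbhd G w)"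
    by (auto simp: legal_L_def closed_nbhd_def)
  \<comment> \<open>Illegality persists: dominated and played vertices only accumulate.\<close>
  moreover have "\<not> legal_L G A (h @ [w]) x" if "\<not> legal_L G A h x" for x
    using that by (auto simp: legal_L_def)
  ultimately show "\<exists>u. legal_L G A h u \<and>
      B \<union> (\<Union>w\<in>set (h' @ [v]). nbhd G w) \<subseteq> A \<union> (\<Union>w\<in>set (h @ [u]). nbhd G w)
      \<and> (\<forall>x\<in>set (h' @ [v]). \<not> legal_L G A (h @ [u]) x)"
    using R v(2) w by (intro exI[of _ w]) auto
qed (use assms in \<open>fastforce simp: legal_L_def\<close>)+

theorem theorem2p1:
  fixes G :: "('a, 'b) pre_digraph" and A B :: "'a set"
  assumes "graph G"
    and "no_isolated_vertices G"
    and "B \<subseteq> A" and "A \<subseteq> verts G"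
  shows "(gamma_Zg G A \<le> gamma_Zg G B \<and> gamma_Zg' G A \<le> gamma_Zg' G B)
       \<and> (gamma_LLg G A \<le> gamma_LLg G B \<and> gamma_LLg' G A \<le> gamma_LLg' G B)
       \<and> (gamma_Lg G A \<le> gamma_Lg G B \<and> gamma_Lg' G A \<le> gamma_Lg' G B)"
  unfolding gamma_Zg_def gamma_Zg'_def gamma_LLg_def gamma_LLg'_def gamma_Lg_def gamma_Lg'_def
  using game_length_Z_antimono[OF assms(1-3)] game_length_LL_antimono[OF assms(3), of G]
    game_length_L_antimono[OF assms(3), of G]
  by simp

end
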